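(* Suppose $W\in\mathscr{X}^{\ast}:=\mathscr{X}\setminus\{\mathcal{N}\}$, $\mathcal{X}\subseteq\mathscr{X}$ with $\mathcal{N}\in\mathcal{X}$, and $\pi_W\colon\mathcal{X}\to\mathscr{X}$ is the hypergraph addition/deletion partial transformation, i.e. for $X\in\mathcal{X}$, $\pi_W(X)=\bigoplus\big(\mathcal{C}(X)\boxplus\mathcal{C}(W)\big)$ if $\mathcal{C}(W)\subseteq\mathcal{C}(X)$ or $V(W)\cap V(X)=\emptyset$, and $\pi_W(X)=X$ if $\mathcal{C}(W)\nsubseteq\mathcal{C}(X)$ and $V(W)\cap V(X)\ne\emptyset$. Define $\mathcal{S}:=\{\mathcal{N},W\}$, and for $X\in\mathcal{X}$ define $\mathcal{D}_X:=\{\mathcal{N},W\}$ if $\mathcal{C}(W)\subseteq\mathcal{C}(X)$ and $\mathcal{D}_X:=\{\mathcal{N}\}$ if $\mathcal{C}(W)\nsubseteq\mathcal{C}(X)$. Then $\mathcal{T}_W:=(\mathcal{X},\pi_W,\mathcal{S})$ is a hypergraph transformation on $\mathscr{X}$ with $\mathcal{S}$-maximal subsets $\{\mathcal{D}_X\}_{X\in\mathcal{X}}$, and the collection of distinguished hypergraphs $\mathcal{S}$ is greatest for $\pi_W$ with respect to inclusion (that is, among the collections $\mathcal{S}'$ such that $(\mathcal{X},\pi_W,\mathcal{S}')$ is a hypergraph transformation on $\mathscr{X}$).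
   Context: Hypergraphs. A hypergraph is a pair $X=(V(X),E(X))$ of finite sets, where $V(X)$ is the vertex set and $E(X)\subseteq\mathcal{P}(V(X))$ (the power set) is the hyperedge set; the empty hyperedge is excluded and multiple hyperedges are allowed. Fix nonempty disjoint sets of labels $L_V$ and $L_E$. All hypergraphs are vertex- and hyperedge-labelled, meaning that they carry injective labelling functions $V(X)\to L_V$ and $E(X)\to L_E$ (so that multiple hyperedges are distinguished by their labels); the labellings are not mentioned explicitly. $\mathscr{X}$ denotes the universe of all vertex- and hyperedge-labelled hypergraphs over $L_V$ and $L_E$, called the hypergraph family, and $\mathcal{N}$ denotes the null hypergraph (no vertices and no hyperedges). $X$ is a strong subhypergraph of $Y$ if $V(X)\subseteq V(Y)$ and $E(X)\subseteq E(Y)$. A hypergraph is connected if it is nonnull and any two of its vertices are joined by a path; $\mathcal{C}(X)$ denotes the set of connected components of $X$ (maximal connected strong subhypergraphs), so $\mathcal{C}(\mathcal{N})=\emptyset$. $X,Y$ are (vertex) disjoint if $V(X)\cap V(Y)=\emptyset$, and component disjoint if $\mathcal{C}(X)\cap\mathcal{C}(Y)=\emptyset$. For pairwise disjoint hypergraphs $X_i$, the direct sum $\bigoplus_i X_i$ has vertex set $\bigcup_i V(X_i)$ and hyperedge set $\bigcup_i E(X_i)$; the empty direct sum is $\mathcal{N}$. For a set $\mathcal{A}$ of pairwise disjoint hypergraphs, $\bigoplus\mathcal{A}$ is the direct sum of its members. If $X=Y\oplus Z$ with $Y,Z$ disjoint, the direct difference is $X\ominus Z:=Y$. For sets of connected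 components, $\boxplus$ denotes symmetric difference. Component maximality. For $\mathcal{S}\subseteq\mathcal{X}\subseteq\mathscr{X}$, $\mathcal{S}$ is component maximal in $\mathcal{X}$ if for each $X\in\mathcal{X}$ there is a subset $\mathcal{D}_X\subseteq\mathcal{S}$, called an $\mathcal{S}$-maximal subset, such that: (1) $\mathcal{D}_X$ is pairwise component disjoint; (2) if $\mathcal{N}\in\mathcal{S}$ then $\mathcal{N}\in\mathcal{D}_X$; (3) $\mathcal{C}(T)\subseteq\mathcal{C}(X)$ for all $T\in\mathcal{D}_X$; (4) if $S\in\mathcal{S}$ and $\mathcal{C}(S)\subseteq\mathcal{C}(X)$ then there is $T\in\mathcal{D}_X$ with $\mathcal{C}(S)\subseteq\mathcal{C}(T)$. Hypergraph transformation. A partial transformation on $\mathscr{X}$ is a map $\pi\colon\mathcal{X}\to\mathscr{X}$ with $\mathcal{X}\subseteq\mathscr{X}$. A hypergraph transformation on $\mathscr{X}$ is a triple $(\mathcal{X},\pi,\mathcal{S})$ where $\pi\colon\mathcal{X}\to\mathscr{X}$ is a partial transformation and $\mathcal{S}\subseteq\mathcal{X}$ is a collection of distinguished hypergraphs such that: (1) (nonredundancy) $\mathcal{C}(S)\cap\mathcal{C}(\pi(S))=\emptyset$ for all $S\in\mathcal{S}$, and if $\mathcal{N}\in\mathcal{S}$ then $\pi(\mathcal{N})\ne\mathcal{N}$; (2) (maximality) $\mathcal{S}$ is component maximal in $\mathcal{X}$, with $\mathcal{S}$-maximal subsets $\{\mathcal{D}_X\}_{X\in\mathcal{X}}$; (3)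 (direct sum decomposition is preserved) for each $X\in\mathcal{X}$, with $\mathcal{S}_X:=\{S\in\mathcal{D}_X\mid V(\pi(S))\cap V(X\ominus S)=\emptyset\}$, the set $\pi(\mathcal{S}_X)$ consists of pairwise vertex-disjoint hypergraphs, $|\pi(\mathcal{S}_X)|=|\mathcal{S}_X|$, and $\pi(X)=\overline{X}\oplus\bigoplus_{S\in\mathcal{S}_X}\pi(S)$ where $\overline{X}:=X\ominus\bigoplus_{S\in\mathcal{S}_X}S$.
   Formalization: The formal theorem additionally assumes that $W\in\mathcal{X}$, the domain of $\pi_W$; without this $\mathcal{S}=\{\mathcal{N},W\}\subseteq\mathcal{X}$ fails (e.g. $\mathcal{X}=\{\mathcal{N}\}$) and the claim is false. *)

theory Defs
  imports Main
begin

text \<open>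
  A vertex is identified with its label, and a hyperedge is a pair \<open>(l, e)\<close> of its label and its set
  of end vertices, so that parallel hyperedges differ in their labels.  Equality of hypergraphs is
  then equality as labelled hypergraphs.
\<close>

datatype 'a hypergraph =
  Hypergraph (verts: "'a set") (edges: "('a \<times> 'a set) set")

text \<open>The condition \<open>inj_on fst\<close> says that the hyperedge labelling is injective.\<close>

definition is_hypergraph :: "'a hypergraph \<Rightarrow> bool" where
  "is_hypergraph X \<longleftrightarrow>
     finite (verts X) \<and> finite (edges X) \<and>
     (\<forall>(l, e) \<in> edges X. e \<noteq> {} \<and> e \<subseteq> verts X) \<and>
     inj_on fst (edges X)"

definition hypergraph_family :: "'a set \<Rightarrow> 'a set \<Rightarrow> 'a hypergraph set" where
  "hypergraph_family LV LE =
     {X. is_hypergraph X \<and> verts X \<subseteq> LV \<and> fst ` edges X \<subseteq> LE}"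

definition null_hypergraph :: "'a hypergraph"  ("\<N>") where
  "\<N> = Hypergraph {} {}"

definition strong_subhypergraph :: "'a hypergraph \<Rightarrow> 'a hypergraph \<Rightarrow> bool" where
  "strong_subhypergraph X Y \<longleftrightarrow>
     is_hypergraph X \<and> is_hypergraph Y \<and> verts X \<subseteq> verts Y \<and> edges X \<subseteq> edges Y"

text \<open>
  A path alternates distinct vertices \<open>vs\<close> and distinct hyperedges \<open>es\<close>; a single vertex is a path
  of length zero.
\<close>

definition hypergraph_path ::
  "'a hypergraph \<Rightarrow> 'a list \<Rightarrow> ('a \<times> 'a set) list \<Rightarrow> bool" where
  "hypergraph_path X vs es \<longleftrightarrow>
     length vs = Suc (length es) \<and> distinct vs \<and> distinct es \<and>
     set vs \<subseteq> verts X \<and> set es \<subseteq> edges X \<and>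
     (\<forall>i < length es. vs ! i \<in> snd (es ! i) \<and> vs ! Suc i \<in> snd (es ! i))"

definition connected_hypergraph :: "'a hypergraph \<Rightarrow> bool" where
  "connected_hypergraph X \<longleftrightarrow>
     is_hypergraph X \<and> X \<noteq> \<N> \<and>
     (\<forall>u \<in> verts X. \<forall>v \<in> verts X. \<exists>vs es. hypergraph_path X vs es \<and> hd vs = u \<and> last vs = v)"

definition components :: "'a hypergraph \<Rightarrow> 'a hypergraph set"  ("\<C>") where
  "\<C> X = {Y. strong_subhypergraph Y X \<and> connected_hypergraph Y \<and>
            (\<forall>Z. strong_subhypergraph Z X \<and> connected_hypergraph Z \<and>
                 strong_subhypergraph Y Z \<longrightarrow> Z = Y)}"

definition disjoint_hypergraphs :: "'a hypergraph \<Rightarrow> 'a hypergraph \<Rightarrow> bool" where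
  "disjoint_hypergraphs X Y \<longleftrightarrow> verts X \<inter> verts Y = {}"

definition component_disjoint :: "'a hypergraph \<Rightarrow> 'a hypergraph \<Rightarrow> bool" where
  "component_disjoint X Y \<longleftrightarrow> \<C> X \<inter> \<C> Y = {}"

text \<open>
  Direct sums are only meant for pairwise disjoint hypergraphs.  Labels are kept, so the sum is a
  labelled hypergraph only if the summands share no hyperedge label.
\<close>

definition direct_sum :: "'a hypergraph set \<Rightarrow> 'a hypergraph"  ("\<Oplus>_" [90] 90) where
  "\<Oplus>\<A> = Hypergraph (\<Union>X \<in> \<A>. verts X) (\<Union>X \<in> \<A>. edges X)"

definition direct_add :: "'a hypergraph \<Rightarrow> 'a hypergraph \<Rightarrow> 'a hypergraph"
    (infixl "\<oplus>" 65) where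
  "Y \<oplus> Z = Hypergraph (verts Y \<union> verts Z) (edges Y \<union> edges Z)"

text \<open>Meaningful only if \<open>Z\<close> is a direct summand of \<open>X\<close>; the other summand is then unique.\<close>

definition direct_diff :: "'a hypergraph \<Rightarrow> 'a hypergraph \<Rightarrow> 'a hypergraph"
    (infixl "\<ominus>" 65) where
  "X \<ominus> Z = (THE Y. is_hypergraph Y \<and> disjoint_hypergraphs Y Z \<and> X = Y \<oplus> Z)"

definition maximal_subset ::
  "'a hypergraph set \<Rightarrow> 'a hypergraph \<Rightarrow> 'a hypergraph set \<Rightarrow> bool" where
  "maximal_subset \<S> X D \<longleftrightarrow>
     D \<subseteq> \<S> \<and>
     pairwise component_disjoint D \<and>
     (\<N> \<in> \<S> \<longrightarrow> \<N> \<in> D) \<and>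
     (\<forall>T \<in> D. \<C> T \<subseteq> \<C> X) \<and>
     (\<forall>S \<in> \<S>. \<C> S \<subseteq> \<C> X \<longrightarrow> (\<exists>T \<in> D. \<C> S \<subseteq> \<C> T))"

text \<open>
  Below, \<open>U\<close> is the hypergraph family and \<open>\<X>\<close> the domain of a partial transformation; the values
  of \<open>\<pi>\<close> and \<open>D\<close> outside \<open>\<X>\<close> play no role.
\<close>

definition partial_transformation ::
  "'a hypergraph set \<Rightarrow> 'a hypergraph set \<Rightarrow> ('a hypergraph \<Rightarrow> 'a hypergraph) \<Rightarrow> bool" where
  "partial_transformation U \<X> \<pi> \<longleftrightarrow> \<X> \<subseteq> U \<and> \<pi> ` \<X> \<subseteq> U"

definition component_maximal_with ::
  "'a hypergraph set \<Rightarrow> 'a hypergraph set \<Rightarrow> 'a hypergraph set \<Rightarrow>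
   ('a hypergraph \<Rightarrow> 'a hypergraph set) \<Rightarrow> bool" where
  "component_maximal_with U \<X> \<S> D \<longleftrightarrow>
     \<S> \<subseteq> \<X> \<and> \<X> \<subseteq> U \<and> (\<forall>X \<in> \<X>. maximal_subset \<S> X (D X))"

definition preserved_summands ::
  "('a hypergraph \<Rightarrow> 'a hypergraph) \<Rightarrow> ('a hypergraph \<Rightarrow> 'a hypergraph set) \<Rightarrow>
   'a hypergraph \<Rightarrow> 'a hypergraph set" where
  "preserved_summands \<pi> D X = {S \<in> D X. verts (\<pi> S) \<inter> verts (X \<ominus> S) = {}}"

text \<open>
  The maximal subset \<open>D X\<close> is finite, so equality of cardinalities says that \<open>\<pi>\<close> is injective on
  \<open>preserved_summands \<pi> D X\<close>.
\<close>

definition hypergraph_transformation_with ::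
  "'a hypergraph set \<Rightarrow> 'a hypergraph set \<Rightarrow> ('a hypergraph \<Rightarrow> 'a hypergraph) \<Rightarrow>
   'a hypergraph set \<Rightarrow> ('a hypergraph \<Rightarrow> 'a hypergraph set) \<Rightarrow> bool" where
  "hypergraph_transformation_with U \<X> \<pi> \<S> D \<longleftrightarrow>
     partial_transformation U \<X> \<pi> \<and> \<S> \<subseteq> \<X> \<and>
     (\<forall>S \<in> \<S>. \<C> S \<inter> \<C> (\<pi> S) = {}) \<and> (\<N> \<in> \<S> \<longrightarrow> \<pi> \<N> \<noteq> \<N>) \<and>
     component_maximal_with U \<X> \<S> D \<and>
     (\<forall>X \<in> \<X>.
        let SX = preserved_summands \<pi> D X in
          pairwise disjoint_hypergraphs (\<pi> ` SX) \<and>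
          card (\<pi> ` SX) = card SX \<and>
          \<pi> X = (X \<ominus> \<Oplus>SX) \<oplus> \<Oplus>(\<pi> ` SX))"

definition hypergraph_transformation ::
  "'a hypergraph set \<Rightarrow> 'a hypergraph set \<Rightarrow> ('a hypergraph \<Rightarrow> 'a hypergraph) \<Rightarrow>
   'a hypergraph set \<Rightarrow> bool" where
  "hypergraph_transformation U \<X> \<pi> \<S> \<longleftrightarrow> (\<exists>D. hypergraph_transformation_with U \<X> \<pi> \<S> D)"

definition addition_deletion :: "'a hypergraph \<Rightarrow> 'a hypergraph \<Rightarrow> 'a hypergraph" where
  "addition_deletion W X =
     (if \<C> W \<subseteq> \<C> X \<or> verts W \<inter> verts X = {}
      then \<Oplus>(sym_diff (\<C> X) (\<C> W)) else X)"

end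

theory Submission
  imports Defs
begin

text \<open>
  A hypergraph is the direct sum of its components, so it is determined by them, and every set of
  pairwise disjoint connected hypergraphs consists of components of its direct sum, provided that
  the sum is a hypergraph
  (\<open>direct_sum_components\<close>, \<open>components_eqD\<close>, \<open>subset_components_direct_sum\<close>).  Hence the symmetric
  difference of components acts in only two ways: it sends \<open>X\<close> to \<open>X \<oplus> W\<close> if \<open>W\<close> and \<open>X\<close> are
  disjoint, and to \<open>X \<ominus> W\<close> if \<open>W\<close> is a union of components of \<open>X\<close>.  In particular it swaps \<open>\<N>\<close>
  and \<open>W\<close>.

  Adding \<open>W\<close> is therefore the replacement of the summand \<open>\<N>\<close> by its image \<open>W\<close>, and deleting \<open>W\<close> is
  the replacement of the summand \<open>W\<close> by its image \<open>\<N>\<close>.  The set of preserved summands selects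
  exactly the right replacement: \<open>\<N>\<close> is preserved iff \<open>W\<close> and \<open>X\<close> are disjoint, and \<open>W\<close>, having the
  null image, is preserved whenever it belongs to the maximal subset.

  Nonredundancy alone bounds the distinguished hypergraphs.  A nonnull \<open>S\<close> keeps all its
  components when it is fixed or when \<open>W\<close> is added to it, and it keeps those outside \<open>W\<close> when \<open>W\<close> is
  deleted from it.  So it can lose all its components only if \<open>\<C> S = \<C> W\<close>, that is, \<open>S = W\<close>.
\<close>

section \<open>Connectedness by edge-closed vertex sets\<close>

text \<open>
  The vertices and the hyperedges of a path have to be distinct, so paths cannot simply be
  concatenated.  Connectedness is therefore reduced to vertex sets that no hyperedge leaves, which
  behave well under unions of hypergraphs.
\<close>

definition edge_closed :: "'a hypergraph \<Rightarrow> 'a set \<Rightarrow> bool" where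
  "edge_closed X A \<longleftrightarrow> (\<forall>(l, e) \<in> edges X. e \<inter> A \<noteq> {} \<longrightarrow> e \<subseteq> A)"

lemma edge_closedD:
  "edge_closed X A \<Longrightarrow> p \<in> edges X \<Longrightarrow> u \<in> snd p \<Longrightarrow> u \<in> A \<Longrightarrow> v \<in> snd p \<Longrightarrow> v \<in> A"
  unfolding edge_closed_def by fastforce

lemma is_hypergraph_edgeD:
  "is_hypergraph X \<Longrightarrow> (l, e) \<in> edges X \<Longrightarrow> e \<noteq> {} \<and> e \<subseteq> verts X"
  unfolding is_hypergraph_def by blast

lemma hypergraph_path_in_edge_closed:
  assumes p: "hypergraph_path X vs es" and A: "edge_closed X A" and hd: "hd vs \<in> A"
  shows "set vs \<subseteq> A"
proof -
  have "vs ! i \<in> A" if "i < length vs" for i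
    using that
  proof (induction i)
    case 0
    then show ?case using hd by (simp add: hd_conv_nth)
  next
    case (Suc i)
    then have i: "i < length es" and v: "vs ! i \<in> A"
      using p by (auto simp: hypergraph_path_def)
    have "es ! i \<in> edges X" "vs ! i \<in> snd (es ! i)" "vs ! Suc i \<in> snd (es ! i)"
      using p i by (auto simp: hypergraph_path_def)
    then show ?case using edge_closedD[OF A] v by blast
  qed
  then show ?thesis by (auto simp: in_set_conv_nth)
qed

lemma hypergraph_path_take:
  assumes "hypergraph_path X vs es" "i < length vs"
  shows "hypergraph_path X (take (Suc i) vs) (take i es)"
  using assms unfolding hypergraph_path_def
  by (auto dest!: in_set_takeD)

text \<open>
  Cutting the path at its first vertex on the new hyperedge \<open>p\<close> makes the extension a path: a
  hyperedge of the remaining part equal to \<open>p\<close> would give an earlier vertex on \<open>p\<close>, and the new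
  vertex \<open>x\<close> can only repeat the vertex at which the path was cut.
\<close>

lemma hypergraph_path_extend:
  assumes p: "hypergraph_path X vs es" and e: "p \<in> edges X" "snd p \<subseteq> verts X"
    and l: "last vs \<in> snd p" and x: "x \<in> snd p"
  shows "\<exists>vs' es'. hypergraph_path X vs' es' \<and> hd vs' = hd vs \<and> last vs' = x"
proof -
  have ne: "vs \<noteq> []" using p by (auto simp: hypergraph_path_def)
  define i where "i = (LEAST i. i < length vs \<and> vs ! i \<in> snd p)"
  have "length vs - 1 < length vs \<and> vs ! (length vs - 1) \<in> snd p"
    using ne l by (simp add: last_conv_nth)
  then have i: "i < length vs \<and> vs ! i \<in> snd p"
    unfolding i_def by (rule LeastI)
  have least: "i \<le> j" if "j < length vs" "vs ! j \<in> snd p" for j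
    unfolding i_def using that by (intro Least_le) simp
  let ?vs = "take (Suc i) vs" and ?es = "take i es"
  have q: "hypergraph_path X ?vs ?es"
    using hypergraph_path_take[OF p] i by blast
  have hd: "hd ?vs = hd vs" using ne by (cases vs) auto
  have last: "last ?vs = vs ! i" using i by (simp add: take_Suc_conv_app_nth)
  show ?thesis
  proof (cases "x \<in> set ?vs")
    case True
    then obtain j where "j \<le> i" "j < length vs" "x = vs ! j"
      by (fastforce simp: in_set_conv_nth less_Suc_eq_le)
    then have "x = vs ! i" using least x by fastforce
    then show ?thesis using q hd last by blast
  next
    case False
    have "p \<notin> set ?es"
    proof
      assume "p \<in> set ?es"
      then obtain j where j: "j < i" "j < length es" "p = es ! j"
        by (auto simp: in_set_conv_nth)
      then have "vs ! j \<in> snd p" "j < length vs" using p by (auto simp: hypergraph_path_def)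
      then show False using least j by fastforce
    qed
    moreover have len: "length ?es = i" "length ?vs = Suc i"
      using i p by (auto simp: hypergraph_path_def)
    moreover have "(?vs @ [x]) ! j \<in> snd ((?es @ [p]) ! j) \<and> (?vs @ [x]) ! Suc j \<in> snd ((?es @ [p]) ! j)"
      if "j < Suc i" for j
    proof (cases "j = i")
      case True
      then show ?thesis using len i x by (simp add: nth_append)
    next
      case False
      then have "j < length ?es" using that len by simp
      then show ?thesis using q len by (auto simp: nth_append hypergraph_path_def)
    qed
    ultimately have "hypergraph_path X (?vs @ [x]) (?es @ [p])"
      using q e x False unfolding hypergraph_path_def by auto
    then show ?thesis using hd ne by (metis hd_append2 last_snoc take_eq_Nil2 nat.distinct(1))
  qed
qed

text \<open>
  The vertices reachable from a fixed vertex form an edge-closed set, and conversely a path never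
  leaves an edge-closed set.
\<close>

lemma connected_iff_edge_closed:
  "connected_hypergraph X \<longleftrightarrow>
     is_hypergraph X \<and> X \<noteq> \<N> \<and>
     (\<forall>A. edge_closed X A \<and> verts X \<inter> A \<noteq> {} \<longrightarrow> verts X \<subseteq> A)"
    (is "?L \<longleftrightarrow> ?R")
proof
  assume L: ?L
  have "verts X \<subseteq> A" if A: "edge_closed X A" and u: "u \<in> verts X" "u \<in> A" for A u
  proof
    fix v assume "v \<in> verts X"
    then obtain vs es where p: "hypergraph_path X vs es" "hd vs = u" "last vs = v"
      using L u unfolding connected_hypergraph_def by blast
    then have "vs \<noteq> []" by (auto simp: hypergraph_path_def)
    then show "v \<in> A" using hypergraph_path_in_edge_closed[OF p(1) A] p u last_in_set by blast
  qed
  then show ?R using L unfolding connected_hypergraph_def by blast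
next
  assume R: ?R
  have "\<exists>vs es. hypergraph_path X vs es \<and> hd vs = u \<and> last vs = v"
    if u: "u \<in> verts X" and v: "v \<in> verts X" for u v
  proof -
    define A where "A = {v. \<exists>vs es. hypergraph_path X vs es \<and> hd vs = u \<and> last vs = v}"
    have "hypergraph_path X [u] []" using u by (simp add: hypergraph_path_def)
    then have "u \<in> A" unfolding A_def by force
    moreover have "edge_closed X A"
      unfolding edge_closed_def
    proof clarify
      fix l e w x assume e: "(l, e) \<in> edges X" "x \<in> e" and w: "e \<inter> A \<noteq> {}"
      then obtain w vs es where "w \<in> e" "hypergraph_path X vs es" "hd vs = u" "last vs = w"
        unfolding A_def by blast
      then show "x \<in> A"
        using hypergraph_path_extend[of X vs es "(l, e)" x] e is_hypergraph_edgeD[of X l e] R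
        unfolding A_def by auto
    qed
    ultimately show ?thesis using R u v unfolding A_def by blast
  qed
  then show ?L using R by (simp add: connected_hypergraph_def)
qed

lemma connected_in_edge_closed:
  "connected_hypergraph X \<Longrightarrow> edge_closed X A \<Longrightarrow> verts X \<inter> A \<noteq> {} \<Longrightarrow> verts X \<subseteq> A"
  by (simp add: connected_iff_edge_closed)

section \<open>Components and direct sums\<close>

lemma verts_direct_add [simp]: "verts (Y \<oplus> Z) = verts Y \<union> verts Z"
  and edges_direct_add [simp]: "edges (Y \<oplus> Z) = edges Y \<union> edges Z"
  by (simp_all add: direct_add_def)

lemma verts_direct_sum [simp]: "verts (\<Oplus>\<A>) = (\<Union>X \<in> \<A>. verts X)"
  and edges_direct_sum [simp]: "edges (\<Oplus>\<A>) = (\<Union>X \<in> \<A>. edges X)"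
  by (simp_all add: direct_sum_def)

lemma verts_null [simp]: "verts \<N> = {}" and edges_null [simp]: "edges \<N> = {}"
  by (simp_all add: null_hypergraph_def)

lemma hypergraph_eqI: "verts X = verts Y \<Longrightarrow> edges X = edges Y \<Longrightarrow> X = Y"
  by (cases X; cases Y) simp

lemma direct_sum_Un: "\<Oplus>(\<A> \<union> \<B>) = \<Oplus>\<A> \<oplus> \<Oplus>\<B>"
  by (rule hypergraph_eqI) auto

lemma direct_sum_empty [simp]: "\<Oplus>{} = \<N>"
  and direct_sum_singleton [simp]: "\<Oplus>{X} = X"
  and direct_add_null [simp]: "X \<oplus> \<N> = X"
  by (rule hypergraph_eqI; simp)+

lemma is_hypergraph_null [simp]: "is_hypergraph \<N>"
  by (simp add: is_hypergraph_def)

lemma null_if_no_verts: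
  assumes "is_hypergraph X" "verts X = {}"
  shows "X = \<N>"
  using assms by (intro hypergraph_eqI) (auto simp: is_hypergraph_def)

lemma is_hypergraph_subhypergraph:
  assumes "is_hypergraph X" "verts Y \<subseteq> verts X" "edges Y \<subseteq> edges X"
    "\<And>l e. (l, e) \<in> edges Y \<Longrightarrow> e \<subseteq> verts Y"
  shows "is_hypergraph Y"
  using assms(1-3) unfolding is_hypergraph_def
  by (auto intro: finite_subset inj_on_subset dest: assms(4)[THEN subsetD])

lemma connectedD:
  assumes "connected_hypergraph X"
  shows "is_hypergraph X" "X \<noteq> \<N>" "verts X \<noteq> {}"
  using assms null_if_no_verts by (auto simp: connected_hypergraph_def)

lemma componentD:
  assumes "K \<in> \<C> X"
  shows "strong_subhypergraph K X" "connected_hypergraph K" "is_hypergraph K"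
    "verts K \<subseteq> verts X" "edges K \<subseteq> edges X" "verts K \<noteq> {}"
  using assms connectedD[of K] by (auto simp: components_def strong_subhypergraph_def)

lemma components_null [simp]: "\<C> \<N> = {}"
  using componentD(4,6) by fastforce

lemma connected_direct_add:
  assumes "connected_hypergraph Y" "connected_hypergraph Z" "is_hypergraph (Y \<oplus> Z)"
    and v: "v \<in> verts Y" "v \<in> verts Z"
  shows "connected_hypergraph (Y \<oplus> Z)"
proof -
  have "verts (Y \<oplus> Z) \<subseteq> A" if A: "edge_closed (Y \<oplus> Z) A" "verts (Y \<oplus> Z) \<inter> A \<noteq> {}" for A
  proof -
    have "edge_closed Y A" "edge_closed Z A" using A(1) by (auto simp: edge_closed_def)
    note Y = connected_in_edge_closed[OF assms(1) this(1)]
      and Z = connected_in_edge_closed[OF assms(2) this(2)]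
    have "verts Y \<subseteq> A \<or> verts Z \<subseteq> A" using A(2) Y Z by auto
    then show ?thesis using Y Z v by auto
  qed
  moreover have "Y \<oplus> Z \<noteq> \<N>" using v by (metis UnI1 empty_iff verts_direct_add verts_null)
  ultimately show ?thesis using assms(3) by (simp add: connected_iff_edge_closed)
qed

lemma components_disjoint:
  assumes X: "is_hypergraph X" and K: "K \<in> \<C> X" and L: "L \<in> \<C> X" and "K \<noteq> L"
  shows "verts K \<inter> verts L = {}"
proof (rule ccontr)
  assume "verts K \<inter> verts L \<noteq> {}"
  then obtain v where v: "v \<in> verts K" "v \<in> verts L" by blast
  note k = componentD[OF K] and l = componentD[OF L]
  have h: "is_hypergraph (K \<oplus> L)"
    using k l is_hypergraph_edgeD[of K] is_hypergraph_edgeD[of L]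
    by (intro is_hypergraph_subhypergraph[OF X]) fastforce+
  have c: "connected_hypergraph (K \<oplus> L)"
    by (rule connected_direct_add[OF k(2) l(2) h v])
  have "strong_subhypergraph (K \<oplus> L) X" "strong_subhypergraph K (K \<oplus> L)"
    "strong_subhypergraph L (K \<oplus> L)"
    using h X k l by (auto simp: strong_subhypergraph_def)
  then have "K \<oplus> L = K" "K \<oplus> L = L" using K L c by (auto simp: components_def)
  then show False using \<open>K \<noteq> L\<close> by simp
qed

text \<open>A connected strong subhypergraph of largest total size above \<open>Y\<close> is a component.\<close>

lemma connected_subset_component:
  assumes Y: "strong_subhypergraph Y X" "connected_hypergraph Y"
  obtains K where "K \<in> \<C> X" "strong_subhypergraph Y K"
proof -
  define P where "P K \<longleftrightarrow> strong_subhypergraph K X \<and> connected_hypergraph K \<and> strong_subhypergraph Y K" for K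
  define m where "m K = card (verts K) + card (edges K)" for K :: "'a hypergraph"
  have X: "is_hypergraph X" using Y by (simp add: strong_subhypergraph_def)
  have PY: "P Y" using Y connectedD[of Y] by (simp add: P_def strong_subhypergraph_def)
  have "m K < Suc (m X)" if "P K" for K
    using that X unfolding P_def m_def strong_subhypergraph_def is_hypergraph_def
    by (auto intro!: add_mono card_mono simp: less_Suc_eq_le)
  then obtain K where K: "P K" "\<And>Z. P Z \<Longrightarrow> m Z \<le> m K"
    using ex_has_greatest_nat[of P Y m "Suc (m X)"] PY by (metis less_imp_le)
  have "Z = K" if Z: "strong_subhypergraph Z X" "connected_hypergraph Z" "strong_subhypergraph K Z" for Z
  proof -
    have "P Z" using Z K(1) unfolding P_def strong_subhypergraph_def by auto
    then have "m Z \<le> m K" by (rule K(2))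
    moreover have sub: "verts K \<subseteq> verts Z" "edges K \<subseteq> edges Z" "finite (verts Z)" "finite (edges Z)"
      using Z by (auto simp: strong_subhypergraph_def is_hypergraph_def)
    moreover have "card (verts K) \<le> card (verts Z)" "card (edges K) \<le> card (edges Z)"
      using sub by (auto intro: card_mono)
    ultimately have "card (verts K) = card (verts Z)" "card (edges K) = card (edges Z)"
      unfolding m_def by linarith+
    then have "verts K = verts Z" "edges K = edges Z" using sub by (simp_all add: card_subset_eq)
    then show ?thesis by (metis hypergraph_eqI)
  qed
  then have "K \<in> \<C> X" using K(1) unfolding P_def components_def by blast
  then show thesis using that K(1) unfolding P_def by blast
qed

lemma connected_single_vertex: "connected_hypergraph (Hypergraph {v} {})"
  by (auto simp: connected_iff_edge_closed is_hypergraph_def null_hypergraph_def)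

lemma connected_single_edge:
  "finite e \<Longrightarrow> e \<noteq> {} \<Longrightarrow> connected_hypergraph (Hypergraph e {(l, e)})"
  by (auto simp: connected_iff_edge_closed is_hypergraph_def null_hypergraph_def edge_closed_def)

text \<open>
  Every vertex and every hyperedge forms a connected strong subhypergraph, which lies in a
  component.
\<close>

lemma direct_sum_components:
  assumes X: "is_hypergraph X"
  shows "\<Oplus>(\<C> X) = X"
proof (rule hypergraph_eqI)
  have "\<exists>K \<in> \<C> X. v \<in> verts K" if "v \<in> verts X" for v
  proof -
    have "strong_subhypergraph (Hypergraph {v} {}) X"
      using that X by (auto simp: strong_subhypergraph_def is_hypergraph_def)
    then obtain K where "K \<in> \<C> X" "strong_subhypergraph (Hypergraph {v} {}) K"
      using connected_subset_component[OF _ connected_single_vertex] by metis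
    then show ?thesis by (auto simp: strong_subhypergraph_def)
  qed
  then show "verts (\<Oplus>(\<C> X)) = verts X" using componentD(4) by fastforce
  have "\<exists>K \<in> \<C> X. (l, e) \<in> edges K" if le: "(l, e) \<in> edges X" for l e
  proof -
    have e: "e \<noteq> {}" "e \<subseteq> verts X" using is_hypergraph_edgeD[OF X le] by auto
    moreover have "finite e" using e X by (auto simp: is_hypergraph_def intro: finite_subset)
    ultimately have c: "connected_hypergraph (Hypergraph e {(l, e)})"
      by (intro connected_single_edge)
    then have "strong_subhypergraph (Hypergraph e {(l, e)}) X"
      using le e X connectedD(1)[OF c] by (auto simp: strong_subhypergraph_def)
    then obtain K where "K \<in> \<C> X" "strong_subhypergraph (Hypergraph e {(l, e)}) K"
      using connected_subset_component[OF _ c] by metis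
    then show ?thesis by (auto simp: strong_subhypergraph_def)
  qed
  then show "edges (\<Oplus>(\<C> X)) = edges X" using componentD(5) by fastforce
qed

lemma components_eqD:
  "is_hypergraph X \<Longrightarrow> is_hypergraph Y \<Longrightarrow> \<C> X = \<C> Y \<Longrightarrow> X = Y"
  by (metis direct_sum_components)

lemma components_eq_empty_iff: "is_hypergraph X \<Longrightarrow> \<C> X = {} \<longleftrightarrow> X = \<N>"
  using components_eqD[of X \<N>] by auto

text \<open>
  The vertex set of a summand is edge-closed in the direct sum, so a connected strong
  subhypergraph that meets a summand lies inside it.
\<close>

lemma subset_components_direct_sum:
  assumes conn: "\<And>K. K \<in> \<A> \<Longrightarrow> connected_hypergraph K"
    and disj: "pairwise disjoint_hypergraphs \<A>"
    and hyp: "is_hypergraph (\<Oplus>\<A>)"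
  shows "\<A> \<subseteq> \<C> (\<Oplus>\<A>)"
proof
  fix K assume K: "K \<in> \<A>"
  have eq: "L = K" if "L \<in> \<A>" "v \<in> verts L" "v \<in> verts K" for L v
    using disj that K by (auto simp: pairwise_def disjoint_hypergraphs_def)
  note k = connectedD[OF conn[OF K]]
  have "Z = K" if Z: "strong_subhypergraph Z (\<Oplus>\<A>)" "connected_hypergraph Z" "strong_subhypergraph K Z" for Z
  proof -
    have in_K: "(l, e) \<in> edges K" if le: "(l, e) \<in> edges Z" "v \<in> e" "v \<in> verts K" for l e v
    proof -
      obtain L where L: "L \<in> \<A>" "(l, e) \<in> edges L"
        using Z(1) le by (auto simp: strong_subhypergraph_def)
      then have "v \<in> verts L"
        using is_hypergraph_edgeD[OF connectedD(1)[OF conn]] le by blast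
      then show ?thesis using eq L le by blast
    qed
    then have "edge_closed Z (verts K)"
      unfolding edge_closed_def using is_hypergraph_edgeD[OF k(1)] by blast
    then have verts: "verts Z \<subseteq> verts K"
      using connected_in_edge_closed[OF Z(2)] Z(3) k(3) by (auto simp: strong_subhypergraph_def)
    have "edges Z \<subseteq> edges K"
    proof clarify
      fix l e assume le: "(l, e) \<in> edges Z"
      then show "(l, e) \<in> edges K"
        using is_hypergraph_edgeD[OF connectedD(1)[OF Z(2)] le] verts in_K by blast
    qed
    then show ?thesis using verts Z(3) by (intro hypergraph_eqI) (auto simp: strong_subhypergraph_def)
  qed
  moreover have "strong_subhypergraph K (\<Oplus>\<A>)"
    using K k hyp by (auto simp: strong_subhypergraph_def)
  ultimately show "K \<in> \<C> (\<Oplus>\<A>)" using conn[OF K] by (auto simp: components_def)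
qed

text \<open>
  The summand is unique because the hyperedges of \<open>Z\<close>, being nonempty, cannot lie on the vertices
  of \<open>Y\<close>.
\<close>

lemma direct_diff_eqI:
  assumes "is_hypergraph Y" "is_hypergraph Z" "verts Y \<inter> verts Z = {}" "X = Y \<oplus> Z"
  shows "X \<ominus> Z = Y"
  unfolding direct_diff_def
proof (rule the_equality)
  show "is_hypergraph Y \<and> disjoint_hypergraphs Y Z \<and> X = Y \<oplus> Z"
    using assms by (simp add: disjoint_hypergraphs_def)
next
  fix Y' assume "is_hypergraph Y' \<and> disjoint_hypergraphs Y' Z \<and> X = Y' \<oplus> Z"
  then have Y': "is_hypergraph Y'" "verts Y' \<inter> verts Z = {}" "X = Y' \<oplus> Z"
    by (simp_all add: disjoint_hypergraphs_def)
  have split: "verts U = verts X - verts Z" "edges U = edges X - edges Z"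
    if "is_hypergraph U" "verts U \<inter> verts Z = {}" "X = U \<oplus> Z" for U
  proof -
    have "edges U \<inter> edges Z = {}"
      using that is_hypergraph_edgeD[OF that(1)] is_hypergraph_edgeD[OF assms(2)] by fastforce
    then show "edges U = edges X - edges Z" using that by auto
    show "verts U = verts X - verts Z" using that by auto
  qed
  show "Y' = Y"
    by (rule hypergraph_eqI) (simp_all only: split[OF Y'] split[OF assms(1,3,4)])
qed

lemma direct_diff_null [simp]: "is_hypergraph X \<Longrightarrow> X \<ominus> \<N> = X"
  by (rule direct_diff_eqI) auto

section \<open>Addition and deletion of a hypergraph\<close>

lemma components_disjoint_if_verts_disjoint:
  "verts X \<inter> verts Y = {} \<Longrightarrow> \<C> X \<inter> \<C> Y = {}"
  using componentD(4,6) by fastforce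

lemma verts_subset_if_components_subset:
  assumes "is_hypergraph X" "is_hypergraph Y" "\<C> X \<subseteq> \<C> Y"
  shows "verts X \<subseteq> verts Y"
proof -
  have "verts (\<Oplus>(\<C> X)) \<subseteq> verts (\<Oplus>(\<C> Y))" using assms(3) by auto
  then show ?thesis using assms direct_sum_components by metis
qed

lemma addition_deletion_add_eq_sum:
  "verts W \<inter> verts X = {} \<Longrightarrow> addition_deletion W X = \<Oplus>(\<C> X \<union> \<C> W)"
  using components_disjoint_if_verts_disjoint[of X W]
  by (auto simp: addition_deletion_def Int_commute intro!: arg_cong[of _ _ direct_sum])

lemma addition_deletion_add:
  assumes "is_hypergraph W" "is_hypergraph X" "verts W \<inter> verts X = {}"
  shows "addition_deletion W X = X \<oplus> W"
  using assms by (simp add: addition_deletion_add_eq_sum direct_sum_Un direct_sum_components)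

lemma addition_deletion_delete_eq_sum:
  "\<C> W \<subseteq> \<C> X \<Longrightarrow> addition_deletion W X = \<Oplus>(\<C> X - \<C> W)"
  by (auto simp: addition_deletion_def intro!: arg_cong[of _ _ direct_sum])

lemma is_hypergraph_direct_sum_subset_components:
  assumes X: "is_hypergraph X" and "\<A> \<subseteq> \<C> X"
  shows "is_hypergraph (\<Oplus>\<A>)"
proof (rule is_hypergraph_subhypergraph[OF X])
  show "verts (\<Oplus>\<A>) \<subseteq> verts X" "edges (\<Oplus>\<A>) \<subseteq> edges X"
    using assms(2) componentD(4,5) by fastforce+
  show "e \<subseteq> verts (\<Oplus>\<A>)" if le: "(l, e) \<in> edges (\<Oplus>\<A>)" for l e
  proof -
    from le obtain K where K: "K \<in> \<A>" "(l, e) \<in> edges K" by auto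
    then have "is_hypergraph K" using assms(2) componentD(3) by blast
    then show ?thesis using K is_hypergraph_edgeD[of K l e] by auto
  qed
qed

lemma addition_deletion_delete:
  assumes W: "is_hypergraph W" and X: "is_hypergraph X" and sub: "\<C> W \<subseteq> \<C> X"
  shows "addition_deletion W X = X \<ominus> W"
proof -
  let ?Y = "\<Oplus>(\<C> X - \<C> W)"
  have "is_hypergraph ?Y" by (rule is_hypergraph_direct_sum_subset_components[OF X]) blast
  moreover have "verts ?Y \<inter> verts (\<Oplus>(\<C> W)) = {}"
    using components_disjoint[OF X] sub by auto
  moreover have "\<Oplus>(\<C> X) = ?Y \<oplus> \<Oplus>(\<C> W)"
    using sub by (simp add: direct_sum_Un[symmetric] Un_absorb2)
  ultimately have "X \<ominus> W = ?Y" using W X by (intro direct_diff_eqI) (simp_all add: direct_sum_components)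
  then show ?thesis using addition_deletion_delete_eq_sum[OF sub] by simp
qed

lemma addition_deletion_null: "is_hypergraph W \<Longrightarrow> addition_deletion W \<N> = W"
  by (simp add: addition_deletion_add_eq_sum direct_sum_components)

lemma addition_deletion_self: "addition_deletion W W = \<N>"
  by (simp add: addition_deletion_delete_eq_sum)

text \<open>
  The image has to be assumed a hypergraph because \<open>W\<close> and \<open>S\<close> may share a hyperedge label even if
  they share no vertex.
\<close>

lemma components_outside_preserved:
  assumes W: "is_hypergraph W" and S: "is_hypergraph S"
    and img: "is_hypergraph (addition_deletion W S)"
  shows "\<C> S - \<C> W \<subseteq> \<C> (addition_deletion W S)"
proof -
  consider (del) "\<C> W \<subseteq> \<C> S" | (add) "verts W \<inter> verts S = {}" | (fixed) "addition_deletion W S = S"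
    unfolding addition_deletion_def by argo
  then show ?thesis
  proof cases
    case del
    then show ?thesis
      using img componentD(2) components_disjoint[OF S]
        subset_components_direct_sum[of "\<C> S - \<C> W"]
      by (auto simp: addition_deletion_delete_eq_sum pairwise_def disjoint_hypergraphs_def)
  next
    case add
    have "pairwise disjoint_hypergraphs (\<C> S \<union> \<C> W)"
      using components_disjoint[OF S] components_disjoint[OF W] add
        componentD(4)[of _ S] componentD(4)[of _ W]
      unfolding pairwise_def disjoint_hypergraphs_def by blast
    then show ?thesis
      using img componentD(2) add subset_components_direct_sum[of "\<C> S \<union> \<C> W"]
      by (auto simp: addition_deletion_add_eq_sum)
  next
    case fixed
    then show ?thesis by auto
  qed
qed

text \<open>
  If \<open>S\<close> has components but shares none with its image, then all of them are components of \<open>W\<close>.  So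
  \<open>S\<close> meets \<open>W\<close>, and, not being fixed, it can only be subject to deletion of \<open>W\<close>.
\<close>

lemma nonredundant_imp_distinguished:
  assumes W: "is_hypergraph W" and S: "is_hypergraph S"
    and img: "is_hypergraph (addition_deletion W S)"
    and nonred: "\<C> S \<inter> \<C> (addition_deletion W S) = {}"
  shows "S \<in> {\<N>, W}"
proof (cases "\<C> S = {}")
  case True
  then show ?thesis using S by (simp add: components_eq_empty_iff)
next
  case False
  have sub: "\<C> S \<subseteq> \<C> W" using components_outside_preserved[OF W S img] nonred by blast
  have "addition_deletion W S \<noteq> S" using False nonred by auto
  then have "\<C> W \<subseteq> \<C> S \<or> verts W \<inter> verts S = {}"
    unfolding addition_deletion_def by argo
  moreover have "verts W \<inter> verts S \<noteq> {}"
    using components_disjoint_if_verts_disjoint[of W S] sub False by blast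
  ultimately show ?thesis using sub components_eqD[OF S W] by blast
qed

lemma maximal_subset_addition_deletion:
  "maximal_subset {\<N>, W} X (if \<C> W \<subseteq> \<C> X then {\<N>, W} else {\<N>})"
  by (auto simp: maximal_subset_def pairwise_def component_disjoint_def)

text \<open>
  The image \<open>W\<close> of \<open>\<N>\<close> is always compared with all of \<open>X\<close>, and it meets \<open>X\<close> whenever \<open>W\<close> is a
  summand of \<open>X\<close>; the image of \<open>W\<close> is null and meets nothing.
\<close>

lemma preserved_summands_addition_deletion:
  assumes W: "is_hypergraph W" "W \<noteq> \<N>" and X: "is_hypergraph X"
  shows "preserved_summands (addition_deletion W) (\<lambda>X. if \<C> W \<subseteq> \<C> X then {\<N>, W} else {\<N>}) X =
    (if \<C> W \<subseteq> \<C> X then {W} else if verts W \<inter> verts X = {} then {\<N>} else {})"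
proof -
  have "verts W \<inter> verts X \<noteq> {}" if "\<C> W \<subseteq> \<C> X"
    using verts_subset_if_components_subset[OF W(1) X that] null_if_no_verts W by blast
  then show ?thesis
    using W X addition_deletion_null[OF W(1)]
    by (auto simp: preserved_summands_def addition_deletion_self)
qed

theorem proposition3p29:
  fixes LV LE :: "'a set" and W :: "'a hypergraph" and \<X> :: "'a hypergraph set"
  assumes "LV \<noteq> {}" and "LE \<noteq> {}" and "LV \<inter> LE = {}"
    and "W \<in> hypergraph_family LV LE - {\<N>}"
    and "\<X> \<subseteq> hypergraph_family LV LE"
    and "\<N> \<in> \<X>" and "W \<in> \<X>"
    and "partial_transformation (hypergraph_family LV LE) \<X> (addition_deletion W)"
  shows "hypergraph_transformation_with (hypergraph_family LV LE) \<X> (addition_deletion W) {\<N>, W}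
           (\<lambda>X. if \<C> W \<subseteq> \<C> X then {\<N>, W} else {\<N>})
       \<and> (\<forall>\<S>'. hypergraph_transformation (hypergraph_family LV LE) \<X> (addition_deletion W) \<S>'
               \<longrightarrow> \<S>' \<subseteq> {\<N>, W})"
proof -
  have W: "is_hypergraph W" "W \<noteq> \<N>" using assms(4) by (auto simp: hypergraph_family_def)
  have dom: "is_hypergraph X" if "X \<in> \<X>" for X
    using that assms(5) by (auto simp: hypergraph_family_def)
  have img: "is_hypergraph (addition_deletion W X)" if "X \<in> \<X>" for X
    using that assms(8) by (auto simp: hypergraph_family_def partial_transformation_def)
  note swap = addition_deletion_null[OF W(1)] addition_deletion_self[of W]
  have "let SX = preserved_summands (addition_deletion W)
                   (\<lambda>X. if \<C> W \<subseteq> \<C> X then {\<N>, W} else {\<N>}) X in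
          pairwise disjoint_hypergraphs (addition_deletion W ` SX) \<and>
          card (addition_deletion W ` SX) = card SX \<and>
          addition_deletion W X = (X \<ominus> \<Oplus>SX) \<oplus> \<Oplus>(addition_deletion W ` SX)"
    if "X \<in> \<X>" for X
  proof -
    consider (del) "\<C> W \<subseteq> \<C> X"
      | (add) "\<not> \<C> W \<subseteq> \<C> X" "verts W \<inter> verts X = {}"
      | (fixed) "\<not> \<C> W \<subseteq> \<C> X" "verts W \<inter> verts X \<noteq> {}"
      by blast
    then show ?thesis
    proof cases
      case del
      then show ?thesis
        using preserved_summands_addition_deletion[OF W dom[OF that]]
          addition_deletion_delete[OF W(1) dom[OF that]]
        by (simp add: Let_def swap)
    next
      case add
      then show ?thesis
        using preserved_summands_addition_deletion[OF W dom[OF that]]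
          addition_deletion_add[OF W(1) dom[OF that]] dom[OF that]
        by (simp add: Let_def swap)
    next
      case fixed
      then have "addition_deletion W X = X" by (simp add: addition_deletion_def)
      then show ?thesis
        using preserved_summands_addition_deletion[OF W dom[OF that]] dom[OF that] fixed
        by (simp add: Let_def)
    qed
  qed
  then have "hypergraph_transformation_with (hypergraph_family LV LE) \<X> (addition_deletion W)
      {\<N>, W} (\<lambda>X. if \<C> W \<subseteq> \<C> X then {\<N>, W} else {\<N>})"
    using assms W maximal_subset_addition_deletion[of W]
    unfolding hypergraph_transformation_with_def component_maximal_with_def
    by (simp add: swap)
  moreover have "\<S>' \<subseteq> {\<N>, W}"
    if "hypergraph_transformation (hypergraph_family LV LE) \<X> (addition_deletion W) \<S>'" for \<S>'
  proof
    fix S assume "S \<in> \<S>'"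
    with that have "S \<in> \<X>" "\<C> S \<inter> \<C> (addition_deletion W S) = {}"
      by (auto simp: hypergraph_transformation_def hypergraph_transformation_with_def)
    then show "S \<in> {\<N>, W}" using nonredundant_imp_distinguished W(1) dom img by blast
  qed
  ultimately show ?thesis by blast
qed

end
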